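(* There is a set $C\subset\mathbb{D}$ such that $C$ is a Cantor set, where $\mathbb{D}$ is the set of Diophantine numbers.
   Context: $\mathbb{N}=\{0,1,2,\ldots\}$. A set $X\subset\mathbb{R}$ is nowhere dense if $\operatorname{int}(\overline{X})=\emptyset$. A set $C\subset\mathbb{R}$ is perfect if $C=C'$, where $C'$ is the set of all accumulation points of $C$ in $\mathbb{R}$. A Cantor set is a nonempty set $C\subset\mathbb{R}$ that is nowhere dense and perfect (this is the definition used; boundedness is not required). A number $\alpha\in\mathbb{R}\setminus\mathbb{Q}$ is a Liouville number if for all $n\in\mathbb{N}$ there exist integers $p,q$ (depending on $n$) with $q>1$ and $0<\left|\alpha-\frac{p}{q}\right|<\frac{1}{q^n}$. A real number that is not a Liouville number is called a Diophantine number (so rational numbers are Diophantine in this sense). $\mathbb{D}$ denotes the set of Diophantine numbers. *)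

theory Defs
  imports "HOL-Analysis.Analysis"
begin

definition nowhere_dense :: "real set \<Rightarrow> bool" where
  "nowhere_dense X \<longleftrightarrow> interior (closure X) = {}"

definition perfect :: "real set \<Rightarrow> bool" where
  "perfect C \<longleftrightarrow> C = {x. x islimpt C}"

(* Boundedness is not part of this notion of Cantor set. *)
definition cantor_set :: "real set \<Rightarrow> bool" where
  "cantor_set C \<longleftrightarrow> C \<noteq> {} \<and> nowhere_dense C \<and> perfect C"

definition liouville :: "real \<Rightarrow> bool" where
  "liouville \<alpha> \<longleftrightarrow> \<alpha> \<notin> \<rat> \<and>
     (\<forall>n::nat. \<exists>p q :: int. q > 1 \<and>
        0 < \<bar>\<alpha> - of_int p / of_int q\<bar> \<and> \<bar>\<alpha> - of_int p / of_int q\<bar> < 1 / of_int q ^ n)"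

(* Rational numbers are Diophantine in this sense. *)
definition Diophantine :: "real set" where
  "Diophantine = {\<alpha>. \<not> liouville \<alpha>}"

end

theory Submission
  imports Defs
begin

text \<open>
  The Liouville numbers are covered by arbitrarily small unions of open intervals around rationals,
  so a closed set of positive measure avoids them. Concretely, remove from \<open>[0, 1]\<close> the open
  interval of radius \<open>1 / q\<^sup>7\<close> around every fraction \<open>p / q\<close> with \<open>q \<ge> 2\<close>. The total measure removed
  is at most \<open>1 / 2\<close> (\<open>measure_UN_near_fractions_le\<close>), so the remaining set \<open>K\<close> is uncountable
  (\<open>uncountable_far_from_fractions\<close>). It contains no Liouville number, because membership in \<open>K\<close>
  refutes the Liouville condition for the exponent \<open>7\<close>. It contains no rational either, since every
  rational can be written with a denominator \<open>q \<ge> 2\<close> and is therefore the centre of a removed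
  interval; being closed, \<open>K\<close> is then nowhere dense.

  The set \<open>K\<close> may have isolated points. By the Cantor-Bendixson argument
  (\<open>uncountable_closed_contains_perfect\<close>) it nevertheless contains a nonempty perfect set, and
  nowhere density passes to that subset.
\<close>

section \<open>Perfect kernels\<close>

text \<open>
  The perfect subset consists of the condensation points of \<open>K\<close>, the points whose neighbourhoods all
  meet \<open>K\<close> in an uncountable set. By the Lindelof property, only countably many points of \<open>K\<close> fail
  to be condensation points, so removing these failures keeps every uncountable trace \<open>T \<inter> K\<close>
  uncountable; hence each condensation point is a limit of others.
\<close>

lemma uncountable_closed_contains_perfect:
  fixes K :: "'a::second_countable_topology set"
  assumes "closed K" "uncountable K"
  obtains P where "P \<subseteq> K" "P \<noteq> {}" "P = {x. x islimpt P}"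
proof -
  define \<V> where "\<V> = {T. open T \<and> countable (T \<inter> K)}"
  define P where "P = - \<Union>\<V>"
  obtain \<W> where \<W>: "\<W> \<subseteq> \<V>" "countable \<W>" "\<Union>\<W> = \<Union>\<V>"
    by (rule Lindelof[of \<V>]) (auto simp: \<V>_def)
  have "countable (\<Union>T\<in>\<W>. T \<inter> K)"
  proof (rule countable_UN[OF \<W>(2)])
    show "countable (T \<inter> K)" if "T \<in> \<W>" for T
      using \<W>(1) that by (auto simp: \<V>_def)
  qed
  moreover have "K - P = (\<Union>T\<in>\<W>. T \<inter> K)"
    using \<W>(3) by (auto simp: P_def)
  ultimately have countable_rest: "countable (K - P)"
    by simp
  have "- K \<in> \<V>"
    using assms(1) by (auto simp: \<V>_def)
  then have "P \<subseteq> K"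
    by (auto simp: P_def)
  moreover have "P \<noteq> {}"
    using countable_rest assms(2) by auto
  moreover have limpt: "x islimpt P" if "x \<in> P" for x
  proof (rule islimptI)
    fix T assume T: "x \<in> T" "open T"
    then have "uncountable (T \<inter> K)"
      using \<open>x \<in> P\<close> by (auto simp: P_def \<V>_def)
    moreover have "T \<inter> K \<subseteq> (T \<inter> P - {x}) \<union> ({x} \<union> (K - P))"
      by blast
    moreover have "countable ({x} \<union> (K - P))"
      using countable_rest by simp
    ultimately have "T \<inter> P - {x} \<noteq> {}"
      by (metis countable_subset sup_bot_left)
    then show "\<exists>y\<in>P. y \<in> T \<and> y \<noteq> x"
      by blast
  qed
  moreover have "closed P"
    by (auto simp: P_def \<V>_def)
  then have "P = {x. x islimpt P}"
    using limpt by (auto simp: closed_limpt)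
  ultimately show ?thesis
    by (intro that)
qed

section \<open>Points far from all fractions\<close>

text \<open>
  For \<open>q \<ge> 2\<close>, the intervals whose numerator is outside this range do not meet \<open>[0, 1]\<close>; leaving
  them out makes the union for a single denominator finite.
\<close>

definition near_fractions :: "nat \<Rightarrow> real set" where
  "near_fractions q = (\<Union>p\<in>{- int q..2 * int q}. ball (of_int p / real q) (1 / real q ^ 7))"

definition far_from_fractions :: "real set" where
  "far_from_fractions = {0..1} - (\<Union>q\<in>{2..}. near_fractions q)"

lemma open_near_fractions: "open (near_fractions q)"
  by (auto simp: near_fractions_def)

lemma fmeasurable_near_fractions: "near_fractions q \<in> fmeasurable lborel"
  unfolding near_fractions_def
  by (intro fmeasurable.finite_UN fmeasurableI emeasure_lborel_ball_finite) auto

text \<open>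
  There are \<open>3 q + 1 \<le> 4 q\<close> intervals of length \<open>2 / q\<^sup>7\<close>. The exponent \<open>7\<close> leaves a spare factor
  \<open>q\<^sup>4 \<ge> 16\<close> with which to absorb the constant \<open>8\<close> and reach a telescoping majorant of sum \<open>1 / 2\<close>.
\<close>

lemma measure_near_fractions_le:
  assumes "q \<ge> 2"
  shows "measure lborel (near_fractions q) \<le> (1 / real (q - 1) - 1 / real q) / 2"
proof -
  have "measure lborel (near_fractions q)
      \<le> (\<Sum>p\<in>{- int q..2 * int q}. measure lborel (ball (of_int p / real q) (1 / real q ^ 7)))"
    unfolding near_fractions_def by (rule measure_UNION_le) auto
  also have "\<dots> = (3 * real q + 1) * (2 / real q ^ 7)"
    by (simp add: ball_eq_greaterThanLessThan)
  also have "\<dots> \<le> (4 * real q) * (2 / real q ^ 7)"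
    using assms by (intro mult_right_mono) auto
  also have "\<dots> = 8 / (real q ^ 4 * real q ^ 2)"
    using assms by (simp add: field_simps power_numeral_reduce)
  also have "\<dots> \<le> 8 / (2 ^ 4 * (real q * (real q - 1)))"
  proof (rule divide_left_mono)
    have "(2::real) ^ 4 \<le> real q ^ 4"
      using assms by (intro power_mono) auto
    moreover have "real q * (real q - 1) \<le> real q ^ 2"
      by (simp add: power2_eq_square algebra_simps)
    ultimately show "2 ^ 4 * (real q * (real q - 1)) \<le> real q ^ 4 * real q ^ 2"
      using assms by (intro mult_mono) auto
  qed (use assms in auto)
  also have "\<dots> = (1 / real (q - 1) - 1 / real q) / 2"
    using assms by (simp add: of_nat_diff field_simps)
  finally show ?thesis .
qed

lemma sum_telescope_reciprocals:
  "(\<Sum>q = 2..Suc n. 1 / real (q - 1) - 1 / real q) = 1 - 1 / real (Suc n)"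
  by (induction n) auto

lemma
  shows fmeasurable_UN_near_fractions: "(\<Union>q\<in>{2..}. near_fractions q) \<in> fmeasurable lborel"
    and measure_UN_near_fractions_le: "measure lborel (\<Union>q\<in>{2..}. near_fractions q) \<le> 1 / 2"
proof -
  have bound: "measure lborel (\<Union>q\<in>I. near_fractions q) \<le> 1 / 2"
    if I: "I \<subseteq> {2..}" "finite I" for I
  proof -
    obtain n where "I \<subseteq> {..n}"
      using I(2) by (metis finite_nat_iff_bounded_le)
    then have sub: "I \<subseteq> {2..Suc n}"
      using I(1) by force
    have "measure lborel (\<Union>q\<in>I. near_fractions q) \<le> (\<Sum>q\<in>I. measure lborel (near_fractions q))"
      by (intro measure_UNION_le I(2) fmeasurableD fmeasurable_near_fractions)
    also have "\<dots> \<le> (\<Sum>q = 2..Suc n. measure lborel (near_fractions q))"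
      using sub by (intro sum_mono2) auto
    also have "\<dots> \<le> (\<Sum>q = 2..Suc n. (1 / real (q - 1) - 1 / real q) / 2)"
      by (intro sum_mono measure_near_fractions_le) auto
    also have "\<dots> = (1 - 1 / real (Suc n)) / 2"
      by (simp only: sum_divide_distrib[symmetric] sum_telescope_reciprocals)
    also have "\<dots> \<le> 1 / 2"
      by simp
    finally show ?thesis .
  qed
  show "(\<Union>q\<in>{2..}. near_fractions q) \<in> fmeasurable lborel"
    by (rule fmeasurable_UN_bound[OF _ fmeasurable_near_fractions bound]) auto
  show "measure lborel (\<Union>q\<in>{2..}. near_fractions q) \<le> 1 / 2"
    by (rule measure_UN_bound[OF _ fmeasurable_near_fractions bound]) auto
qed

lemma closed_far_from_fractions: "closed far_from_fractions"
  unfolding far_from_fractions_def by (intro closed_Diff open_UN ballI open_near_fractions) auto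

lemma uncountable_far_from_fractions: "uncountable far_from_fractions"
proof
  assume "countable far_from_fractions"
  then have null: "far_from_fractions \<in> null_sets lborel"
    by (rule countable_imp_null_set_lborel)
  let ?U = "\<Union>q\<in>{2..}. near_fractions q"
  have "measure lborel {0..1::real} \<le> measure lborel (?U \<union> far_from_fractions)"
    using null fmeasurable_UN_near_fractions
    by (intro measure_mono_fmeasurable fmeasurable.Un) (auto simp: far_from_fractions_def fmeasurable_def)
  also have "\<dots> = measure lborel ?U"
    using null fmeasurable_UN_near_fractions by (intro measure_Un_null_set) (auto simp: fmeasurable_def)
  finally show False
    using measure_UN_near_fractions_le by simp
qed

lemma far_from_fractions_dist:
  fixes p q :: int
  assumes x: "x \<in> far_from_fractions" and q: "q \<ge> 2"
  shows "\<bar>x - of_int p / of_int q\<bar> \<ge> 1 / of_int q ^ 7"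
proof (cases "- q \<le> p \<and> p \<le> 2 * q")
  case True
  have "x \<notin> near_fractions (nat q)"
    using x q by (auto simp: far_from_fractions_def)
  moreover have "p \<in> {- int (nat q)..2 * int (nat q)}" and "real (nat q) = of_int q"
    using True q by auto
  ultimately have "x \<notin> ball (of_int p / of_int q) (1 / of_int q ^ 7)"
    by (auto simp: near_fractions_def simp del: mem_ball)
  then show ?thesis
    by (simp add: dist_real_def abs_minus_commute)
next
  case False
  \<comment> \<open>The fraction lies outside \<open>[-1, 2]\<close>, so its distance to \<open>[0, 1]\<close> already exceeds \<open>1\<close>.\<close>
  then have "of_int p < (- of_int q :: real) \<or> of_int p > (2 * of_int q :: real)"
    by linarith
  then have "of_int p / of_int q < (- 1 :: real) \<or> of_int p / of_int q > (2 :: real)"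
    using q by (simp add: field_simps)
  moreover have "0 \<le> x" "x \<le> 1"
    using x by (auto simp: far_from_fractions_def)
  ultimately have "\<bar>x - of_int p / of_int q\<bar> \<ge> 1"
    by linarith
  moreover have "1 / of_int q ^ 7 \<le> (1::real)"
    using q by (simp add: one_le_power)
  ultimately show ?thesis
    by linarith
qed

lemma far_from_fractions_subset_Diophantine: "far_from_fractions \<subseteq> Diophantine"
proof
  fix x assume x: "x \<in> far_from_fractions"
  have "\<not> liouville x"
  proof
    assume "liouville x"
    then obtain p q :: int where "q > 1" "\<bar>x - of_int p / of_int q\<bar> < 1 / of_int q ^ 7"
      unfolding liouville_def by blast
    then show False
      using far_from_fractions_dist[OF x, of q p] by simp
  qed
  then show "x \<in> Diophantine"
    by (simp add: Diophantine_def)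
qed

lemma far_from_fractions_irrational:
  assumes "x \<in> far_from_fractions"
  shows "x \<notin> \<rat>"
proof
  assume "x \<in> \<rat>"
  then obtain a b :: int where ab: "b > 0" "x = of_int a / of_int b"
    by (metis Rats_cases')
  \<comment> \<open>Doubling numerator and denominator covers the integers, where \<open>b\<close> may be \<open>1\<close>.\<close>
  then have "x = of_int (2 * a) / of_int (2 * b)"
    by simp
  then show False
    using far_from_fractions_dist[OF assms, of "2 * b" "2 * a"] ab(1) by simp
qed

section \<open>A Cantor set of Diophantine numbers\<close>

lemma nowhere_dense_if_no_rationals:
  assumes "closed K" "K \<inter> \<rat> = {}"
  shows "nowhere_dense K"
proof -
  have "interior K \<inter> \<rat> = {}"
    using assms(2) interior_subset by blast
  then have "interior K = {}"
    using open_Int_closure_eq_empty[OF open_interior, of K "\<rat>"] by (simp add: Rats_closure_real)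
  then show ?thesis
    using assms(1) by (simp add: nowhere_dense_def)
qed

lemma nowhere_dense_subset:
  assumes "nowhere_dense K" "P \<subseteq> K"
  shows "nowhere_dense P"
  using assms interior_mono[OF closure_mono] unfolding nowhere_dense_def by blast

theorem theorem3p1:
  shows "\<exists>C. C \<subseteq> Diophantine \<and> cantor_set C"
proof -
  obtain C where C: "C \<subseteq> far_from_fractions" "C \<noteq> {}" "C = {x. x islimpt C}"
    using uncountable_closed_contains_perfect
      [OF closed_far_from_fractions uncountable_far_from_fractions] .
  have "nowhere_dense far_from_fractions"
    using closed_far_from_fractions far_from_fractions_irrational
    by (intro nowhere_dense_if_no_rationals) auto
  then have "cantor_set C"
    using C nowhere_dense_subset by (auto simp: cantor_set_def perfect_def)
  then show ?thesis
    using C(1) far_from_fractions_subset_Diophantine by blast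
qed

end
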